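(* Let $\alpha>0$, $c\in\mathbb{R}^n$, $\gamma>0$ and $\mu>0$. Let $\mathcal{B}:\mathbb{R}^n\to\mathbb{R}\cup\{+\infty\}$ be the barrier function associated with the Euclidean ball $\{x\in\mathbb{R}^n\mid \|x-c\|^2\le\alpha\}$, defined by $$(\forall u\in\mathbb{R}^n)\quad \mathcal{B}(u)=\begin{cases}-\ln(\alpha-\|u-c\|^2) & \text{if } \|u-c\|^2<\alpha,\\ +\infty & \text{otherwise.}\end{cases}$$ Then, for every $x\in\mathbb{R}^n$, the proximity operator $\varphi(x,\mu,\gamma)=\mathrm{prox}_{\gamma\mu\mathcal{B}}(x)$ of $\gamma\mu\mathcal{B}$ at $x$ is given by $$\varphi(x,\mu,\gamma)=c+\frac{\alpha-\kappa(x,\mu,\gamma)^2}{\alpha-\kappa(x,\mu,\gamma)^2+2\gamma\mu}(x-c),$$ where $\kappa(x,\mu,\gamma)$ is the unique solution in $[0,\sqrt{\alpha}[$ of the cubic equation in $z$: $$0=z^3-\|x-c\|z^2-(\alpha+2\gamma\mu)z+\alpha\|x-c\|.$$ In addition, the Jacobian matrix of $\varphi$ with respect to $x$ and the gradients (derivatives) of $\varphi$ with respect to $\mu$ and $\gamma$ are given by $$J_\varphi^{(x)}(x,\mu,\gamma)=\frac{\alpha-\|\varphi(x,\mu,\gamma)-c\|^2}{\alpha-\|\varphi(x,\mu,\gamma)-c\|^2+2\gamma\mu}\,M(x,\mu,\gamma),$$ $$\nabla_\varphi^{(\mu)}(x,\mu,\gamma)=\frac{-2\gamma}{\alpha-\|\varphi(x,\mu,\gamma)-c\|^2+2\gamma\mu}\,M(x,\mu,\gamma)(\varphi(x,\mu,\gamma)-c),$$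 $$\nabla_\varphi^{(\gamma)}(x,\mu,\gamma)=\frac{-2\mu}{\alpha-\|\varphi(x,\mu,\gamma)-c\|^2+2\gamma\mu}\,M(x,\mu,\gamma)(\varphi(x,\mu,\gamma)-c),$$ where $$M(x,\mu,\gamma)=\mathbb{I}_n-\frac{2(x-\varphi(x,\mu,\gamma))(\varphi(x,\mu,\gamma)-c)^\top}{\alpha-3\|\varphi(x,\mu,\gamma)-c\|^2+2\gamma\mu+2(\varphi(x,\mu,\gamma)-c)^\top(x-c)}.$$
   Context: $\|\cdot\|$ is the Euclidean norm on $\mathbb{R}^n$ and $\mathbb{I}_n\in\mathbb{R}^{n\times n}$ the identity matrix. For a proper, convex, lower semicontinuous function $g:\mathbb{R}^n\to\mathbb{R}\cup\{+\infty\}$ and $t>0$, the proximity operator of $tg$ at $x\in\mathbb{R}^n$ is the unique minimizer $\mathrm{prox}_{tg}(x)=\operatorname{argmin}_{u\in\mathbb{R}^n}\ \frac12\|x-u\|^2+t\,g(u)$. The map $\varphi$ is regarded as a function of $(x,\mu,\gamma)\in\mathbb{R}^n\times\,]0,+\infty[\,\times\,]0,+\infty[$ with values in $\mathbb{R}^n$. $J_\varphi^{(x)}$ denotes its Jacobian matrix with respect to $x$, and $\nabla_\varphi^{(\mu)},\nabla_\varphi^{(\gamma)}\in\mathbb{R}^n$ denote its partial derivatives with respect to the scalars $\mu$ and $\gamma$. *)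

theory Defs
  imports "HOL-Analysis.Analysis"
begin

definition is_prox :: "real \<Rightarrow> (real^'n \<Rightarrow> ereal) \<Rightarrow> real^'n \<Rightarrow> real^'n \<Rightarrow> bool" where
  "is_prox t g x p \<longleftrightarrow>
     is_arg_min (\<lambda>u. ereal (1/2 * (norm (x - u))\<^sup>2) + ereal t * g u) (\<lambda>_. True) p"

(* Meaningful only where the minimizer exists and is unique, e.g. for t > 0 and g proper,
   convex and lower semicontinuous. *)
definition prox :: "real \<Rightarrow> (real^'n \<Rightarrow> ereal) \<Rightarrow> real^'n \<Rightarrow> real^'n" where
  "prox t g x = (THE p. is_prox t g x p)"

definition barrier :: "real \<Rightarrow> real^'n \<Rightarrow> real^'n \<Rightarrow> ereal" where
  "barrier \<alpha> c u =
     (if (norm (u - c))\<^sup>2 < \<alpha> then ereal (- ln (\<alpha> - (norm (u - c))\<^sup>2)) else \<infinity>)"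

definition phi :: "real \<Rightarrow> real^'n \<Rightarrow> real^'n \<Rightarrow> real \<Rightarrow> real \<Rightarrow> real^'n" where
  "phi \<alpha> c x \<mu> \<gamma> = prox (\<gamma> * \<mu>) (barrier \<alpha> c) x"

definition is_kappa :: "real \<Rightarrow> real^'n \<Rightarrow> real^'n \<Rightarrow> real \<Rightarrow> real \<Rightarrow> real \<Rightarrow> bool" where
  "is_kappa \<alpha> c x \<mu> \<gamma> z \<longleftrightarrow>
     z \<in> {0..<sqrt \<alpha>} \<and>
     0 = z^3 - norm (x - c) * z\<^sup>2 - (\<alpha> + 2 * \<gamma> * \<mu>) * z + \<alpha> * norm (x - c)"

definition kappa :: "real \<Rightarrow> real^'n \<Rightarrow> real^'n \<Rightarrow> real \<Rightarrow> real \<Rightarrow> real" where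
  "kappa \<alpha> c x \<mu> \<gamma> = (THE z. is_kappa \<alpha> c x \<mu> \<gamma> z)"

(* The matrix v w^T. *)
definition outer :: "real^'n \<Rightarrow> real^'n \<Rightarrow> real^'n^'n" where
  "outer v w = (columnvector v :: real^1^'n) ** (rowvector w :: real^'n^1)"

definition M :: "real \<Rightarrow> real^'n \<Rightarrow> real^'n \<Rightarrow> real \<Rightarrow> real \<Rightarrow> real^'n^'n" where
  "M \<alpha> c x \<mu> \<gamma> =
     (let p = phi \<alpha> c x \<mu> \<gamma> in
      mat 1 - (1 / (\<alpha> - 3 * (norm (p - c))\<^sup>2 + 2 * \<gamma> * \<mu> + 2 * ((p - c) \<bullet> (x - c))))
                *\<^sub>R (2 *\<^sub>R outer (x - p) (p - c)))"

end

theory Submission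
  imports Defs
begin

text \<open>
  Put \<open>t = \<gamma> * \<mu>\<close>, \<open>d = x - c\<close> and \<open>v = p - c\<close>. The first-order condition for \<open>p\<close> to be
  the proximal point is that \<open>v\<close> lies in the open ball and
  \<open>v + (2 * t / (\<alpha> - (norm v)\<^sup>2)) *\<^sub>R v = d\<close>; the map on the left is called \<open>forward\<close> here,
  and the proximity operator is its inverse. Three properties of this map carry the proof.

  It is onto, and its preimages are explicit: the equation forces \<open>v\<close> to be a multiple of \<open>d\<close>,
  and for the length \<open>z\<close> of \<open>v\<close> it becomes the cubic
  \<open>(\<alpha> - z\<^sup>2) * (norm d - z) = 2 * t * z\<close>, which changes sign on \<open>[0, sqrt \<alpha>]\<close>
  (\<open>ball_cubic_has_root\<close>, \<open>forward_of_cubic_root\<close>).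

  A solution is a strict global minimizer, because the objective exceeds its value at \<open>v\<close> by at
  least half the squared distance to \<open>v\<close> (\<open>barrier_objective_growth\<close>, resting on
  \<open>ln y \<le> y - 1\<close>). This yields existence and uniqueness of the proximal point. Uniqueness of the
  root of the cubic follows too: every root in the interval is the length of the one vector \<open>v\<close>.

  It does not shrink distances (\<open>forward_expanding\<close>, from monotonicity of the gradient of the
  barrier). Hence its inverse is continuous, jointly in the point and in \<open>t\<close>, and the inverse
  function rule turns the derivative of \<open>forward\<close> into that of the proximity operator
  (\<open>prox_barrier_has_derivative\<close>). The derivative to be inverted is a multiple of the identity plus
  a rank-one term along \<open>v\<close>, so the Sherman-Morrison formula inverts it and produces the matrix
  \<open>M\<close>. The two partial derivatives in \<open>\<mu>\<close> and \<open>\<gamma>\<close> are both the derivative in \<open>t\<close> composed with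
  the product \<open>\<gamma> * \<mu>\<close>.
\<close>

section \<open>The forward map of the barrier\<close>

text \<open>
  The identity plus \<open>t\<close> times the gradient of the barrier, in coordinates centred at the centre of
  the ball. It is meaningful on the open ball \<open>(norm v)\<^sup>2 < \<alpha>\<close>.
\<close>
definition forward :: "real \<Rightarrow> real \<Rightarrow> 'a::real_inner \<Rightarrow> 'a" where
  "forward \<alpha> t v = v + (2 * t / (\<alpha> - (norm v)\<^sup>2)) *\<^sub>R v"

text \<open>
  The radial weight \<open>r\<close> never decreases with the norm, so \<open>r u *\<^sub>R u\<close> is a monotone vector field;
  the identity plus a monotone field cannot bring two points closer together.
\<close>
lemma forward_expanding:
  fixes u v :: "'a::real_inner"
  assumes t: "0 \<le> t" and u: "(norm u)\<^sup>2 < \<alpha>" and v: "(norm v)\<^sup>2 < \<alpha>"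
  shows "norm (u - v) \<le> norm (forward \<alpha> t u - forward \<alpha> t v)"
proof -
  define r where "r w = 2 * t / (\<alpha> - (norm w)\<^sup>2)" for w :: 'a
  have r0: "0 \<le> r u" "0 \<le> r v" using assms by (auto simp: r_def)
  have mono: "0 \<le> (r u - r v) * ((norm u)\<^sup>2 - (norm v)\<^sup>2)"
  proof (cases "(norm u)\<^sup>2 \<le> (norm v)\<^sup>2")
    case True
    then have "r u \<le> r v" unfolding r_def using t u v
      by (intro divide_left_mono mult_pos_pos) auto
    with True show ?thesis by (simp add: mult_nonpos_nonpos)
  next
    case False
    then have "r v \<le> r u" unfolding r_def using t u v
      by (intro divide_left_mono mult_pos_pos) auto
    with False show ?thesis by simp
  qed
  \<comment> \<open>Polarization, symmetrized in the two weights, so that each term has an evident sign.\<close>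
  have "(r u *\<^sub>R u - r v *\<^sub>R v) \<bullet> (u - v)
      = ((r u + r v) * (norm (u - v))\<^sup>2 + (r u - r v) * ((norm u)\<^sup>2 - (norm v)\<^sup>2)) / 2"
    by (simp add: power2_norm_eq_inner inner_diff inner_commute algebra_simps)
  also have "\<dots> \<ge> 0" using mono r0 by simp
  finally have "(norm (u - v))\<^sup>2 \<le> (u - v) \<bullet> (u - v) + (r u *\<^sub>R u - r v *\<^sub>R v) \<bullet> (u - v)"
    by (simp add: power2_norm_eq_inner)
  also have "\<dots> = (forward \<alpha> t u - forward \<alpha> t v) \<bullet> (u - v)"
    unfolding forward_def r_def by (simp add: inner_diff_left inner_add_left)
  also have "\<dots> \<le> norm (forward \<alpha> t u - forward \<alpha> t v) * norm (u - v)"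
    by (rule norm_cauchy_schwarz)
  finally show ?thesis
    by (cases "u = v") (auto simp: power2_eq_square)
qed

text \<open>
  The cubic is \<open>(\<alpha> - z\<^sup>2) * (\<delta> - z) - 2 * t * z\<close>: at \<open>0\<close> it is \<open>\<alpha> * \<delta> \<ge> 0\<close>, while at
  \<open>sqrt \<alpha>\<close> the first product vanishes and a negative value remains.
\<close>
lemma ball_cubic_has_root:
  fixes \<alpha> t \<delta> :: real
  assumes "0 < \<alpha>" "0 < t" "0 \<le> \<delta>"
  shows "\<exists>z. 0 \<le> z \<and> z < sqrt \<alpha> \<and> z^3 - \<delta> * z\<^sup>2 - (\<alpha> + 2 * t) * z + \<alpha> * \<delta> = 0"
proof -
  define q where "q z = z^3 - \<delta> * z\<^sup>2 - (\<alpha> + 2 * t) * z + \<alpha> * \<delta>" for z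
  have q_end: "q (sqrt \<alpha>) = - 2 * t * sqrt \<alpha>"
    using assms by (simp add: q_def power3_eq_cube algebra_simps)
  then have "q (sqrt \<alpha>) < 0" using assms by simp
  moreover have "0 \<le> q 0" using assms by (simp add: q_def)
  moreover have "continuous_on {0..sqrt \<alpha>} q"
    unfolding q_def by (intro continuous_intros)
  ultimately obtain z where "0 \<le> z" "z \<le> sqrt \<alpha>" "q z = 0"
    using IVT2'[of q "sqrt \<alpha>" 0 0] assms by auto
  with \<open>q (sqrt \<alpha>) < 0\<close> show ?thesis
    by (intro exI[of _ z]) (auto simp: q_def less_le)
qed

text \<open>
  The cubic says \<open>norm d * (\<alpha> - z\<^sup>2) = z * (\<alpha> - z\<^sup>2 + 2 * t)\<close>, which is exactly what makes the
  rescaled vector have length \<open>z\<close>; once the length is known, \<open>forward\<close> undoes the scaling.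
\<close>
lemma forward_of_cubic_root:
  fixes d :: "'a::real_inner"
  assumes t: "0 < t" and z: "0 \<le> z" "z < sqrt \<alpha>"
    and root: "z^3 - norm d * z\<^sup>2 - (\<alpha> + 2 * t) * z + \<alpha> * norm d = 0"
  defines "v \<equiv> ((\<alpha> - z\<^sup>2) / (\<alpha> - z\<^sup>2 + 2 * t)) *\<^sub>R d"
  shows "norm v = z" "(norm v)\<^sup>2 < \<alpha>" "forward \<alpha> t v = d"
proof -
  have s: "z\<^sup>2 < \<alpha>"
    using z by (metis real_sqrt_less_iff real_sqrt_abs abs_of_nonneg)
  define D where "D = \<alpha> - z\<^sup>2 + 2 * t"
  have D: "0 < D" using s t by (simp add: D_def)
  have "norm d * (\<alpha> - z\<^sup>2) = z * D"
    using root by (simp add: D_def algebra_simps power2_eq_square power3_eq_cube)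
  moreover have "norm v = (\<alpha> - z\<^sup>2) / D * norm d"
    using s D by (simp add: v_def D_def)
  ultimately show nv: "norm v = z"
    using D by (simp add: mult.commute)
  with s show "(norm v)\<^sup>2 < \<alpha>" by simp
  have "forward \<alpha> t v = (1 + 2 * t / (\<alpha> - z\<^sup>2)) *\<^sub>R v"
    by (simp add: forward_def nv algebra_simps)
  also have "1 + 2 * t / (\<alpha> - z\<^sup>2) = D / (\<alpha> - z\<^sup>2)"
    using s by (simp add: D_def field_simps)
  finally show "forward \<alpha> t v = d"
    using s D by (simp add: v_def D_def[symmetric])
qed

section \<open>The proximal point\<close>

text \<open>
  The quadratic part expands exactly around \<open>v\<close>, and its linear term is cancelled by a supporting
  hyperplane of the barrier at \<open>v\<close>, since \<open>d - v\<close> is \<open>t\<close> times the gradient there. The hyperplane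
  comes from two inequalities: \<open>ln y \<le> y - 1\<close> at the quotient of the two slacks, then convexity
  of the squared norm.
\<close>
lemma barrier_objective_growth:
  fixes v w :: "'a::real_inner"
  assumes t: "0 < t" and v: "(norm v)\<^sup>2 < \<alpha>" and w: "(norm w)\<^sup>2 < \<alpha>"
    and d: "forward \<alpha> t v = d"
  shows "1/2 * (norm (d - v))\<^sup>2 - t * ln (\<alpha> - (norm v)\<^sup>2) + 1/2 * (norm (w - v))\<^sup>2
      \<le> 1/2 * (norm (d - w))\<^sup>2 - t * ln (\<alpha> - (norm w)\<^sup>2)"
proof -
  define a b where "a = \<alpha> - (norm v)\<^sup>2" and "b = \<alpha> - (norm w)\<^sup>2"
  have ab: "0 < a" "0 < b" using v w by (auto simp: a_def b_def)
  have "ln b - ln a \<le> b / a - 1"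
    using ln_le_minus_one[of "b / a"] ab by (simp add: ln_div)
  also have "\<dots> = ((norm v)\<^sup>2 - (norm w)\<^sup>2) / a"
    using ab by (simp add: a_def b_def field_simps)
  also have "\<dots> \<le> - (2 * (v \<bullet> (w - v))) / a"
  proof (rule divide_right_mono)
    have "0 \<le> (norm (w - v))\<^sup>2" by simp
    then show "(norm v)\<^sup>2 - (norm w)\<^sup>2 \<le> - (2 * (v \<bullet> (w - v)))"
      by (simp add: power2_norm_eq_inner inner_diff inner_commute algebra_simps)
  qed (use ab in simp)
  finally have "t * (ln b - ln a) \<le> t * (- (2 * (v \<bullet> (w - v))) / a)"
    using t by (intro mult_left_mono) auto
  also have "\<dots> = - ((d - v) \<bullet> (w - v))"
    by (simp add: d[symmetric] forward_def a_def)
  finally have "t * ln b - t * ln a \<le> - ((d - v) \<bullet> (w - v))"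
    by (simp add: algebra_simps)
  moreover have "(norm (d - w))\<^sup>2 = (norm (d - v))\<^sup>2 - 2 * ((d - v) \<bullet> (w - v)) + (norm (w - v))\<^sup>2"
    by (simp add: power2_norm_eq_inner inner_diff inner_commute algebra_simps)
  ultimately show ?thesis
    by (simp add: a_def[symmetric] b_def[symmetric] diff_divide_distrib add_divide_distrib)
qed

text \<open>
  The growth inequality compares points inside the ball; outside, the objective is infinite while
  its value at \<open>c + v\<close> is finite.
\<close>
lemma is_prox_barrier_iff:
  fixes c x v p :: "real^'n"
  assumes t: "0 < t" and v: "(norm v)\<^sup>2 < \<alpha>" and d: "forward \<alpha> t v = x - c"
  shows "is_prox t (barrier \<alpha> c) x p \<longleftrightarrow> p = c + v"
proof -
  define f where "f u = ereal (1/2 * (norm (x - u))\<^sup>2) + ereal t * barrier \<alpha> c u" for u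
  have f_in: "f u = ereal (1/2 * (norm (x - c - (u - c)))\<^sup>2 - t * ln (\<alpha> - (norm (u - c))\<^sup>2))"
    if "(norm (u - c))\<^sup>2 < \<alpha>" for u
    using that by (simp add: f_def barrier_def)
  have f_out: "f u = \<infinity>" if "\<not> (norm (u - c))\<^sup>2 < \<alpha>" for u
    using that t by (simp add: f_def barrier_def)
  have strict: "f (c + v) < f u" if "u \<noteq> c + v" for u
  proof (cases "(norm (u - c))\<^sup>2 < \<alpha>")
    case True
    have "u - c - v \<noteq> 0" using that by (metis add.commute diff_eq_eq diff_0_right eq_iff_diff_eq_0)
    then have "0 < (norm (u - c - v))\<^sup>2" by simp
    with barrier_objective_growth[OF t v True d]
    have "1/2 * (norm (x - c - v))\<^sup>2 - t * ln (\<alpha> - (norm v)\<^sup>2)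
        < 1/2 * (norm (x - c - (u - c)))\<^sup>2 - t * ln (\<alpha> - (norm (u - c))\<^sup>2)" by linarith
    then show ?thesis
      using True v by (simp add: f_in)
  qed (use v in \<open>simp add: f_in f_out\<close>)
  show ?thesis
    unfolding is_prox_def is_arg_min_def f_def[symmetric]
    using strict by (metis less_asym)
qed

lemma prox_barrier_eqI:
  fixes c x v :: "real^'n"
  assumes "0 < t" "(norm v)\<^sup>2 < \<alpha>" "forward \<alpha> t v = x - c"
  shows "prox t (barrier \<alpha> c) x = c + v"
  unfolding prox_def is_prox_barrier_iff[OF assms] by simp

lemma forward_surj:
  fixes d :: "'a::real_inner"
  assumes "0 < \<alpha>" "0 < t"
  obtains v where "(norm v)\<^sup>2 < \<alpha>" "forward \<alpha> t v = d"
proof -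
  obtain z where z: "0 \<le> z" "z < sqrt \<alpha>"
      "z^3 - norm d * z\<^sup>2 - (\<alpha> + 2 * t) * z + \<alpha> * norm d = 0"
    using ball_cubic_has_root[OF assms norm_ge_zero] by blast
  from forward_of_cubic_root(2,3)[OF assms(2) z] that show thesis by metis
qed

lemma prox_barrier:
  fixes c x :: "real^'n"
  assumes "0 < \<alpha>" "0 < t"
  defines "p \<equiv> prox t (barrier \<alpha> c) x"
  shows "(norm (p - c))\<^sup>2 < \<alpha>" "forward \<alpha> t (p - c) = x - c"
proof -
  obtain v where v: "(norm v)\<^sup>2 < \<alpha>" "forward \<alpha> t v = x - c"
    using forward_surj[OF assms(1,2)] .
  have "p = c + v"
    unfolding p_def by (rule prox_barrier_eqI[OF assms(2) v])
  with v show "(norm (p - c))\<^sup>2 < \<alpha>" "forward \<alpha> t (p - c) = x - c" by auto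
qed

section \<open>Differentiating the proximity operator\<close>

lemma outer_mult_vec: "outer a b *v h = (b \<bullet> h) *\<^sub>R a"
  by (simp add: outer_def vec_eq_iff matrix_vector_mult_def matrix_matrix_mult_def
      columnvector_def rowvector_def inner_vec_def sum_distrib_left ac_simps)

text \<open>
  The Sherman-Morrison formula, for the inverse of the identity plus \<open>2 / D\<close> times the outer product
  of \<open>a\<close> and \<open>b\<close>.
\<close>
lemma sherman_morrison_mult_vec:
  fixes a b h :: "real^'n"
  assumes "D \<noteq> 0" "D + 2 * (b \<bullet> a) \<noteq> 0"
  shows "(mat 1 - (1 / (D + 2 * (b \<bullet> a))) *\<^sub>R (2 *\<^sub>R outer a b)) *v (h + (2 * (b \<bullet> h) / D) *\<^sub>R a) = h"
proof -
  define k where "k = b \<bullet> a"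
  define e where "e = b \<bullet> h"
  have "2 * e / D - 2 * (e + 2 * e / D * k) / (D + 2 * k) = 0"
    using assms by (simp add: k_def[symmetric] divide_simps) (simp add: algebra_simps)
  moreover have "(mat 1 - (1 / (D + 2 * k)) *\<^sub>R (2 *\<^sub>R outer a b)) *v (h + (2 * e / D) *\<^sub>R a)
      = h + (2 * e / D - 2 * (e + 2 * e / D * k) / (D + 2 * k)) *\<^sub>R a"
    by (simp add: matrix_vector_mult_diff_rdistrib scaleR_matrix_vector_assoc[symmetric]
        outer_mult_vec k_def[symmetric] e_def[symmetric] inner_add_right scaleR_diff_left)
  ultimately show ?thesis
    by (simp only: k_def e_def scaleR_zero_left add_0_right)
qed

text \<open>
  Fix the proximal point \<open>v\<close> at \<open>(x, t)\<close>. By the expansion property at parameter \<open>s\<close>, the proximal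
  point \<open>w\<close> at \<open>(y, s)\<close> is no farther from \<open>v\<close> than \<open>y - c\<close> is from the image of \<open>v\<close> at parameter
  \<open>s\<close>. That bound involves only the fixed \<open>v\<close>, so it is visibly continuous in \<open>(y, s)\<close>, and it
  vanishes at \<open>(x, t)\<close>.
\<close>
lemma isCont_prox_barrier:
  fixes c x :: "real^'n"
  assumes "0 < \<alpha>" "0 < t"
  shows "isCont (\<lambda>(y, s). prox s (barrier \<alpha> c) y) (x, t)"
proof -
  define P where "P = (\<lambda>(y, s). prox s (barrier \<alpha> c) y)"
  define v where "v = P (x, t) - c"
  have v: "(norm v)\<^sup>2 < \<alpha>" "forward \<alpha> t v = x - c"
    using prox_barrier[OF assms, of c x] by (auto simp: v_def P_def)
  define b where "b z = norm ((fst z - c) - forward \<alpha> (snd z) v)" for z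
  have "isCont b (x, t)"
    unfolding b_def forward_def using v by (intro continuous_intros) auto
  then have b0: "(b \<longlongrightarrow> 0) (at (x, t))"
    using v by (simp add: isCont_def b_def)
  have "\<forall>\<^sub>F z in at (x, t). z \<in> UNIV \<times> {0<..}"
    using assms by (intro eventually_at_in_open' open_Times) auto
  then have "\<forall>\<^sub>F z in at (x, t). norm (P z - P (x, t)) \<le> b z"
  proof eventually_elim
    case (elim z)
    then have s: "0 < snd z" by auto
    define w where "w = P z - c"
    have w: "(norm w)\<^sup>2 < \<alpha>" "forward \<alpha> (snd z) w = fst z - c"
      using prox_barrier[OF assms(1) s, of c "fst z"] by (auto simp: w_def P_def split_beta)
    have "norm (w - v) \<le> norm (forward \<alpha> (snd z) w - forward \<alpha> (snd z) v)"
      using s v w by (intro forward_expanding) auto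
    then show ?case
      by (simp add: b_def w) (simp add: v_def w_def)
  qed
  then have "((\<lambda>z. P z - P (x, t)) \<longlongrightarrow> 0) (at (x, t))"
    by (rule Lim_null_comparison[OF _ b0])
  then show ?thesis
    unfolding P_def[symmetric] isCont_def by (simp add: LIM_zero_iff)
qed

lemma forward_has_derivative:
  fixes v :: "'a::real_inner"
  assumes "(norm v)\<^sup>2 < \<alpha>"
  defines "a \<equiv> \<alpha> - (norm v)\<^sup>2"
  shows "((\<lambda>(w, s). forward \<alpha> s w) has_derivative
      (\<lambda>(h, \<sigma>). h + (2 * t / a) *\<^sub>R h + (2 * \<sigma> / a + 4 * t * (v \<bullet> h) / a\<^sup>2) *\<^sub>R v)) (at (v, t))"
proof -
  have "a \<noteq> 0" using assms by simp
  have weight: "((\<lambda>z. 2 * snd z / (\<alpha> - fst z \<bullet> fst z)) has_derivative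
      (\<lambda>z. 2 * snd z / a + 4 * t * (v \<bullet> fst z) / a\<^sup>2)) (at (v, t))"
    using \<open>a \<noteq> 0\<close> unfolding a_def power2_norm_eq_inner
    by (auto intro!: derivative_eq_intros simp: fun_eq_iff inner_commute power2_eq_square divide_simps)
  have "((\<lambda>z. fst z + (2 * snd z / (\<alpha> - fst z \<bullet> fst z)) *\<^sub>R fst z) has_derivative
      (\<lambda>z. fst z + (2 * t / a) *\<^sub>R fst z + (2 * snd z / a + 4 * t * (v \<bullet> fst z) / a\<^sup>2) *\<^sub>R v))
      (at (v, t))"
    by (rule has_derivative_eq_rhs, rule has_derivative_add[OF has_derivative_fst[OF has_derivative_ident]
          has_derivative_scaleR[OF weight has_derivative_fst[OF has_derivative_ident]]])
       (simp add: a_def power2_norm_eq_inner add.assoc)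
  then show ?thesis
    by (simp add: forward_def case_prod_beta' power2_norm_eq_inner)
qed

text \<open>
  The map \<open>F\<close> that sends a proximal point and its parameter back to the pair of data has the
  proximity operator, paired with the parameter, as continuous right inverse on the half space
  \<open>t > 0\<close>, so the inverse function rule applies as soon as the derivative of \<open>F\<close> is inverted.
  Since \<open>x - p\<close> is a positive multiple of \<open>p - c\<close>, multiplying that derivative by \<open>a / (a + 2 * t)\<close>
  turns its action on the point into the identity plus a rank-one map with the two vectors
  \<open>x - p\<close> and \<open>p - c\<close>, whose inverse is \<open>N\<close>. Carrying the parameter along in both maps gives all
  partial derivatives at once.
\<close>
lemma prox_barrier_has_derivative:
  fixes c x :: "real^'n"
  assumes "0 < \<alpha>" "0 < t"
  defines "p \<equiv> prox t (barrier \<alpha> c) x"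
  defines "a \<equiv> \<alpha> - (norm (p - c))\<^sup>2"
  defines "N \<equiv> mat 1 - (1 / (a + 2 * t + 2 * ((p - c) \<bullet> (x - p)))) *\<^sub>R (2 *\<^sub>R outer (x - p) (p - c))"
  shows "((\<lambda>(y, s). prox s (barrier \<alpha> c) y) has_derivative
      (\<lambda>(h, \<sigma>). N *v ((a / (a + 2 * t)) *\<^sub>R h - (2 * \<sigma> / (a + 2 * t)) *\<^sub>R (p - c)))) (at (x, t))"
proof -
  define P where "P = (\<lambda>(y, s). prox s (barrier \<alpha> c) y)"
  define v where "v = p - c"
  define D where "D = a + 2 * t"
  have v: "(norm v)\<^sup>2 < \<alpha>" "forward \<alpha> t v = x - c"
    using prox_barrier[OF assms(1,2), of c x] by (auto simp: v_def p_def)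
  have a: "0 < a" using v by (simp add: a_def v_def)
  have D: "0 < D" using a assms by (simp add: D_def)
  have xp: "x - p = (2 * t / a) *\<^sub>R v"
    using v by (simp add: forward_def a_def v_def algebra_simps)
  \<comment> \<open>This sign is what keeps the Sherman-Morrison denominator away from zero.\<close>
  have "0 \<le> v \<bullet> (x - p)" unfolding xp using a assms(2) by simp
  then have D': "D + 2 * (v \<bullet> (x - p)) \<noteq> 0" using D by simp
  have N: "N = mat 1 - (1 / (D + 2 * (v \<bullet> (x - p)))) *\<^sub>R (2 *\<^sub>R outer (x - p) v)"
    by (simp add: N_def D_def v_def)
  define F where "F = (\<lambda>z. (forward \<alpha> (snd z) (fst z - c) + c, snd z))"
  define F' where "F' = (\<lambda>z. (fst z + (2 * t / a) *\<^sub>R fst z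
      + (2 * snd z / a + 4 * t * (v \<bullet> fst z) / a\<^sup>2) *\<^sub>R v, snd z))"
  define G' where "G' = (\<lambda>z. (N *v ((a / D) *\<^sub>R fst z - (2 * snd z / D) *\<^sub>R v), snd z))"
  have "((\<lambda>z. (P z, snd z)) has_derivative G') (at (x, t))"
  proof (rule has_derivative_inverse_basic[where f = F and f' = F' and T = "UNIV \<times> {0<..}"])
    have shift: "((\<lambda>z. (fst z - c, snd z)) has_derivative (\<lambda>z. z)) (at (p, t))"
      by (auto intro!: derivative_eq_intros)
    define L where "L = (\<lambda>(h, \<sigma>). h + (2 * t / a) *\<^sub>R h + (2 * \<sigma> / a + 4 * t * (v \<bullet> h) / a\<^sup>2) *\<^sub>R v)"
    have "((\<lambda>(w, s). forward \<alpha> s w) has_derivative L) (at (v, t))"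
      using forward_has_derivative[OF v(1), of t] by (simp add: a_def v_def L_def)
    then have "((\<lambda>z. forward \<alpha> (snd z) (fst z - c)) has_derivative (\<lambda>z. fst (F' z))) (at (p, t))"
      using has_derivative_compose[OF shift, of "\<lambda>(w, s). forward \<alpha> s w" L]
      by (simp add: v_def F'_def L_def split_beta)
    then have "(F has_derivative (\<lambda>z. (fst (F' z), snd z))) (at (p, t))"
      unfolding F_def by (auto intro!: derivative_eq_intros)
    then show "(F has_derivative F') (at (P (x, t), snd (x, t)))"
      by (simp add: F'_def P_def p_def)
    have "bounded_linear (\<lambda>z :: (real^'n) \<times> real. 2 * snd z / D)"
      by (intro bounded_linear_compose[OF bounded_linear_divide]
          bounded_linear_const_mult bounded_linear_snd)
    then show "bounded_linear G'"
      unfolding G'_def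
      by (intro bounded_linear_intros bounded_linear_compose[OF matrix_vector_mul_bounded_linear])
    show "G' \<circ> F' = id"
    proof
      fix z :: "(real^'n) \<times> real"
      obtain h \<sigma> where z: "z = (h, \<sigma>)" by fastforce
      have "a / D + a / D * (2 * t / a) = 1" using a D by (simp add: D_def add_divide_distrib[symmetric])
      moreover define k where "k = 2 * \<sigma> / a + 4 * t * (v \<bullet> h) / a\<^sup>2"
      have "a / D * k - 2 * \<sigma> / D = 2 * (v \<bullet> h) / D * (2 * t / a)"
        using a D by (simp add: k_def field_simps power2_eq_square)
      moreover have "(a / D) *\<^sub>R fst (F' z) - (2 * \<sigma> / D) *\<^sub>R v
          = (a / D + a / D * (2 * t / a)) *\<^sub>R h + (a / D * k - 2 * \<sigma> / D) *\<^sub>R v"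
      proof -
        have "fst (F' z) = h + (2 * t / a) *\<^sub>R h + k *\<^sub>R v"
          by (simp add: F'_def z k_def)
        then show ?thesis
          by (simp only: scaleR_add_right scaleR_add_left scaleR_diff_left scaleR_scaleR
              add_diff_eq add.assoc)
      qed
      ultimately have "(a / D) *\<^sub>R fst (F' z) - (2 * \<sigma> / D) *\<^sub>R v
          = h + (2 * (v \<bullet> h) / D) *\<^sub>R (x - p)"
        by (simp only: xp scaleR_scaleR scaleR_one)
      then have "G' (F' z) = (N *v (h + (2 * (v \<bullet> h) / D) *\<^sub>R (x - p)), \<sigma>)"
        by (simp add: G'_def F'_def z)
      then show "(G' \<circ> F') z = id z"
        using sherman_morrison_mult_vec[OF _ D'] D by (simp add: N z)
    qed
    show "isCont (\<lambda>z. (P z, snd z)) (x, t)"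
      using isCont_prox_barrier[OF assms(1,2), where c = c and x = x]
      by (intro continuous_intros) (simp add: P_def)
    show "open (UNIV \<times> {0<..} :: ((real^'n) \<times> real) set)"
      by (intro open_Times) auto
    show "(x, t) \<in> UNIV \<times> {0<..}" using assms by simp
    show "F (P z, snd z) = z" if "z \<in> UNIV \<times> {0<..}" for z
      using that prox_barrier(2)[OF assms(1), of "snd z" c "fst z"]
      by (auto simp: F_def P_def)
  qed
  then have "((\<lambda>z. fst (P z, snd z)) has_derivative (\<lambda>z. fst (G' z))) (at (x, t))"
    by (rule has_derivative_fst)
  then show ?thesis
    by (simp add: P_def G'_def D_def v_def case_prod_beta')
qed

theorem proposition3:
  fixes \<alpha> \<gamma> \<mu> :: real and c x :: "real^'n"
  assumes "\<alpha> > 0" and "\<gamma> > 0" and "\<mu> > 0"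
  shows "(\<exists>!p. is_prox (\<gamma> * \<mu>) (barrier \<alpha> c) x p) \<and>
     (\<exists>!z. is_kappa \<alpha> c x \<mu> \<gamma> z) \<and>
     (phi \<alpha> c x \<mu> \<gamma> =
           c + ((\<alpha> - (kappa \<alpha> c x \<mu> \<gamma>)\<^sup>2) / (\<alpha> - (kappa \<alpha> c x \<mu> \<gamma>)\<^sup>2 + 2 * \<gamma> * \<mu>)) *\<^sub>R (x - c)) \<and>
     (((\<lambda>y. phi \<alpha> c y \<mu> \<gamma>) has_derivative
           (\<lambda>h. (((\<alpha> - (norm (phi \<alpha> c x \<mu> \<gamma> - c))\<^sup>2)
                   / (\<alpha> - (norm (phi \<alpha> c x \<mu> \<gamma> - c))\<^sup>2 + 2 * \<gamma> * \<mu>))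
                 *\<^sub>R M \<alpha> c x \<mu> \<gamma>) *v h)) (at x)) \<and>
     (((\<lambda>m. phi \<alpha> c x m \<gamma>) has_vector_derivative
           ((- 2 * \<gamma>) / (\<alpha> - (norm (phi \<alpha> c x \<mu> \<gamma> - c))\<^sup>2 + 2 * \<gamma> * \<mu>))
             *\<^sub>R (M \<alpha> c x \<mu> \<gamma> *v (phi \<alpha> c x \<mu> \<gamma> - c))) (at \<mu>)) \<and>
     (((\<lambda>g. phi \<alpha> c x \<mu> g) has_vector_derivative
           ((- 2 * \<mu>) / (\<alpha> - (norm (phi \<alpha> c x \<mu> \<gamma> - c))\<^sup>2 + 2 * \<gamma> * \<mu>))
             *\<^sub>R (M \<alpha> c x \<mu> \<gamma> *v (phi \<alpha> c x \<mu> \<gamma> - c))) (at \<gamma>))"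
proof -
  define t where "t = \<gamma> * \<mu>"
  have t: "0 < t" using assms by (simp add: t_def)
  define p where "p = phi \<alpha> c x \<mu> \<gamma>"
  have p_prox: "p = prox t (barrier \<alpha> c) x" by (simp add: p_def phi_def t_def)
  have p: "(norm (p - c))\<^sup>2 < \<alpha>" "forward \<alpha> t (p - c) = x - c"
    using prox_barrier[OF assms(1) t, of c x] by (auto simp: p_prox)

  have kappa_iff: "is_kappa \<alpha> c x \<mu> \<gamma> z \<longleftrightarrow> 0 \<le> z \<and> z < sqrt \<alpha> \<and>
      z^3 - norm (x - c) * z\<^sup>2 - (\<alpha> + 2 * t) * z + \<alpha> * norm (x - c) = 0" for z
    by (auto simp: is_kappa_def t_def mult.assoc)
  \<comment> \<open>Any root yields the proximal point, so the point determines the root as its distance to \<open>c\<close>.\<close>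
  have root: "norm (p - c) = z \<and> p = c + ((\<alpha> - z\<^sup>2) / (\<alpha> - z\<^sup>2 + 2 * t)) *\<^sub>R (x - c)"
    if "is_kappa \<alpha> c x \<mu> \<gamma> z" for z
  proof -
    define v where "v = ((\<alpha> - z\<^sup>2) / (\<alpha> - z\<^sup>2 + 2 * t)) *\<^sub>R (x - c)"
    from that have z: "0 \<le> z" "z < sqrt \<alpha>"
      "z^3 - norm (x - c) * z\<^sup>2 - (\<alpha> + 2 * t) * z + \<alpha> * norm (x - c) = 0"
      by (auto simp: kappa_iff)
    note v = forward_of_cubic_root[OF t z, folded v_def]
    have "p = c + v"
      unfolding p_prox using t v by (intro prox_barrier_eqI)
    then show ?thesis using v by (simp add: v_def)
  qed
  have ex1_kappa: "\<exists>!z. is_kappa \<alpha> c x \<mu> \<gamma> z"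
    using ball_cubic_has_root[OF assms(1) t norm_ge_zero, of "x - c"] root
    unfolding kappa_iff by metis
  then have kappa: "is_kappa \<alpha> c x \<mu> \<gamma> (kappa \<alpha> c x \<mu> \<gamma>)"
    unfolding kappa_def by (rule theI')

  define a where "a = \<alpha> - (norm (p - c))\<^sup>2"
  define N where "N = M \<alpha> c x \<mu> \<gamma>"
  \<comment> \<open>Expanding \<open>x - p\<close> as \<open>(x - c) - (p - c)\<close> accounts for the coefficient 3 in \<open>M\<close>.\<close>
  have "a + 2 * t + 2 * ((p - c) \<bullet> (x - p))
      = \<alpha> - 3 * (norm (p - c))\<^sup>2 + 2 * \<gamma> * \<mu> + 2 * ((p - c) \<bullet> (x - c))"
    by (simp add: a_def t_def power2_norm_eq_inner inner_diff algebra_simps)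
  then have N: "N = mat 1 - (1 / (a + 2 * t + 2 * ((p - c) \<bullet> (x - p)))) *\<^sub>R (2 *\<^sub>R outer (x - p) (p - c))"
    by (simp add: N_def M_def p_def Let_def)
  have deriv: "((\<lambda>(y, s). prox s (barrier \<alpha> c) y) has_derivative
      (\<lambda>(h, \<sigma>). N *v ((a / (a + 2 * t)) *\<^sub>R h - (2 * \<sigma> / (a + 2 * t)) *\<^sub>R (p - c)))) (at (x, t))"
    unfolding N a_def p_prox by (rule prox_barrier_has_derivative[OF assms(1) t])

  have "((\<lambda>y. (y, \<gamma> * \<mu>)) has_derivative (\<lambda>h. (h, 0))) (at x)"
    by (auto intro!: derivative_eq_intros)
  from has_derivative_compose[OF this deriv[unfolded t_def]]
  have dx: "((\<lambda>y. phi \<alpha> c y \<mu> \<gamma>) has_derivative (\<lambda>h. ((a / (a + 2 * t)) *\<^sub>R N) *v h)) (at x)"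
    by (simp add: phi_def t_def matrix_vector_mult_scaleR scaleR_matrix_vector_assoc)
  have scalar: "N *v ((a / (a + 2 * t)) *\<^sub>R 0 - (2 * (k * \<sigma>) / (a + 2 * t)) *\<^sub>R (p - c))
      = \<sigma> *\<^sub>R ((- 2 * k / (a + 2 * t)) *\<^sub>R (N *v (p - c)))" for k \<sigma>
    by (simp flip: scaleR_minus_left add: matrix_vector_mult_scaleR mult_ac)
  have "((\<lambda>m. (x, \<gamma> * m)) has_derivative (\<lambda>\<sigma>. (0, \<gamma> * \<sigma>))) (at \<mu>)"
    by (auto intro!: derivative_eq_intros)
  from has_derivative_compose[OF this deriv[unfolded t_def]]
  have dmu: "((\<lambda>m. phi \<alpha> c x m \<gamma>) has_vector_derivative
      ((- 2 * \<gamma>) / (a + 2 * t)) *\<^sub>R (N *v (p - c))) (at \<mu>)"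
    unfolding has_vector_derivative_def scalar[symmetric] by (simp add: phi_def[abs_def] t_def)
  have "((\<lambda>g. (x, g * \<mu>)) has_derivative (\<lambda>\<sigma>. (0, \<mu> * \<sigma>))) (at \<gamma>)"
    by (auto intro!: derivative_eq_intros)
  from has_derivative_compose[OF this deriv[unfolded t_def]]
  have dgamma: "((\<lambda>g. phi \<alpha> c x \<mu> g) has_vector_derivative
      ((- 2 * \<mu>) / (a + 2 * t)) *\<^sub>R (N *v (p - c))) (at \<gamma>)"
    unfolding has_vector_derivative_def scalar[symmetric] by (simp add: phi_def[abs_def] t_def)

  show ?thesis
  proof (intro conjI)
    show "\<exists>!p. is_prox (\<gamma> * \<mu>) (barrier \<alpha> c) x p"
      unfolding t_def[symmetric] is_prox_barrier_iff[OF t p] by simp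
    show "\<exists>!z. is_kappa \<alpha> c x \<mu> \<gamma> z" by (fact ex1_kappa)
  qed (use dx dmu dgamma root[OF kappa] in
      \<open>simp_all only: a_def N_def p_def t_def mult.assoc\<close>)
qed

end
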